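(* There exists an autonomous Lipschitz vector field $b:\mathbb{R}^2\to\mathbb{R}^2$ for which the following holds: if $\mathcal{S}_b$ is any natural family of solutions to the geometric transport equation $\frac{d}{dt}T_t+\mathcal{L}_{b}T_t=0$ with vector field $b$, then there exist two distinct solutions $(T^i_t)_{t\in[0,1]}\in\mathcal{S}_b$, $i=1,2$, starting from the same initial datum.
   Context: Notation. $\mathrm{M}_k(\mathbb{R}^d)$ is the space of $k$-currents of finite mass in $\mathbb{R}^d$, with $k\in\{0,\dots,d\}$; $\mathbf{M}$ is mass; $\mathscr{D}^k(\mathbb{R}^d)$ is the space of smooth compactly supported $k$-forms. In the statement $d=2$, and no restriction is placed on $k$. $\mathcal{C}=L^1([0,1];\mathrm{M}_k(\mathbb{R}^d))$ is the family of all curves of currents $t\in[0,1]\mapsto T_t\in\mathrm{M}_k(\mathbb{R}^d)$ with $\int_0^1\mathbf{M}(T_t)\,dt<\infty$. Weak solutions for smooth fields. If $b=b(t,x)$ is smooth and $b_t:=b(t,\cdot)$, then $(T_t)_t\in\mathcal{C}$ is a weak solution if $$\int_0^1\Big(\langle T_t,\omega\rangle\psi'(t)+\langle T_t,\mathcal{L}_{b_t}\omega\rangle\psi(t)\Big)\,dt=0\qquad\text{for all }\omega\in\mathscr{D}^k(\mathbb{R}^d),\ \psi\in C_c^\infty((0,1)),\qquad(\ast)$$ where $\mathcal{L}_{b_t}\omega$ is the classical Lie derivative of the differential form $\omega$ along $b_t$. Natural family of solutions. Fix a Borel vector field $b$. A family $\mathcal{S}_b\subset\mathcal{C}$ is a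 natural family of solutions to $\frac{d}{dt}T_t+\mathcal{L}_{b_t}T_t=0$ with vector field $b$ if: (Consistency) if $b$ is smooth in some open set $\Omega$ and $(T_t)_{t\in[0,1]}\in\mathcal{C}$ is a weak solution in the sense of $(\ast)$ supported in $\Omega$, then $(T_t)_{t\in[0,1]}\in\mathcal{S}_b$; (Stability) if $(T^j_t)_{t\in[0,1]}$, $j\in\mathbb{N}$, is a sequence in $\mathcal{S}_b$ with $\sup_j\int_0^1\mathbf{M}(T^j_t)\,dt<\infty$ and if $T_t=\lim_{j\to\infty}T^j_t$ (weak* limit of currents) for every $t$, then also $(T_t)_{t\in[0,1]}\in\mathcal{S}_b$. *)

theory Defs
  imports "HOL-Analysis.Analysis"
begin

section \<open>Smooth functions on open sets\<close>

text \<open>Iterated Frechet differentiability, tested along directions. In finite dimension and for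
  open \<open>S\<close> this is the usual class \<open>C\<^sup>n\<close>.\<close>

primrec Ck_on :: "nat \<Rightarrow> 'a::euclidean_space set \<Rightarrow> ('a \<Rightarrow> 'b::real_normed_vector) \<Rightarrow> bool" where
  "Ck_on 0 S f \<longleftrightarrow> continuous_on S f"
| "Ck_on (Suc n) S f \<longleftrightarrow>
     (\<forall>x\<in>S. f differentiable (at x)) \<and> (\<forall>v. Ck_on n S (\<lambda>x. frechet_derivative f (at x) v))"

definition smooth_on :: "'a::euclidean_space set \<Rightarrow> ('a \<Rightarrow> 'b::real_normed_vector) \<Rightarrow> bool" where
  "smooth_on S f \<longleftrightarrow> (\<forall>n. Ck_on n S f)"

section \<open>Differential forms\<close>

text \<open>A \<open>k\<close>-covector is an alternating \<open>k\<close>-linear function of a list of \<open>k\<close> vectors. It is set to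
  \<open>0\<close> on lists of any other length, so that equality of functions is equality of covectors.\<close>

definition kcovector :: "nat \<Rightarrow> ('a::euclidean_space list \<Rightarrow> real) \<Rightarrow> bool" where
  "kcovector k \<alpha> \<longleftrightarrow>
     (\<forall>vs. length vs \<noteq> k \<longrightarrow> \<alpha> vs = 0) \<and>
     (\<forall>vs i. length vs = k \<longrightarrow> i < k \<longrightarrow> linear (\<lambda>v. \<alpha> (vs[i := v]))) \<and>
     (\<forall>vs i j. length vs = k \<longrightarrow> i < j \<longrightarrow> j < k \<longrightarrow> vs ! i = vs ! j \<longrightarrow> \<alpha> vs = 0)"

definition orthonormal_list :: "'a::euclidean_space list \<Rightarrow> bool" where
  "orthonormal_list vs \<longleftrightarrow>
     (\<forall>i<length vs. \<forall>j<length vs. vs ! i \<bullet> vs ! j = (if i = j then 1 else 0))"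

text \<open>The unit simple \<open>k\<close>-vectors are exactly the wedge products of orthonormal lists of
  length \<open>k\<close>, so this is the supremum of \<open>\<alpha>\<close> over unit simple \<open>k\<close>-vectors.\<close>

definition comass :: "nat \<Rightarrow> ('a::euclidean_space list \<Rightarrow> real) \<Rightarrow> ennreal" where
  "comass k \<alpha> = (SUP vs\<in>{vs. length vs = k \<and> orthonormal_list vs}. ennreal \<bar>\<alpha> vs\<bar>)"

type_synonym 'a form = "'a \<Rightarrow> 'a list \<Rightarrow> real"

definition form_support :: "'a::euclidean_space form \<Rightarrow> 'a set" where
  "form_support \<omega> = closure {x. \<exists>vs. \<omega> x vs \<noteq> 0}"

definition test_forms :: "nat \<Rightarrow> 'a::euclidean_space form set" where
  "test_forms k = {\<omega>. (\<forall>x. kcovector k (\<omega> x)) \<and> (\<forall>vs. smooth_on UNIV (\<lambda>x. \<omega> x vs)) \<and>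
                       compact (form_support \<omega>)}"

text \<open>The classical Lie derivative, evaluated on constant vector fields \<open>v\<^sub>i\<close>, where
  \<open>[b, v\<^sub>i] = - Db v\<^sub>i\<close>.\<close>

definition lie_derivative ::
    "('a::euclidean_space \<Rightarrow> 'a) \<Rightarrow> 'a form \<Rightarrow> 'a form" where
  "lie_derivative b \<omega> = (\<lambda>x vs.
     frechet_derivative (\<lambda>y. \<omega> y vs) (at x) (b x) +
     (\<Sum>i<length vs. \<omega> x (vs[i := frechet_derivative b (at x) (vs ! i)])))"

section \<open>Currents of finite mass\<close>

type_synonym 'a current = "'a form \<Rightarrow> real"

definition mass :: "nat \<Rightarrow> 'a::euclidean_space current \<Rightarrow> ennreal" where
  "mass k T = (SUP \<omega>\<in>{\<omega>\<in>test_forms k. \<forall>x. comass k (\<omega> x) \<le> 1}. ennreal (T \<omega>))"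

text \<open>Finite mass implies continuity in the topology of test forms, so only linearity is
  required. Functionals are set to \<open>0\<close> off the test forms to make equality extensional.\<close>

definition finite_mass_currents :: "nat \<Rightarrow> 'a::euclidean_space current set" where
  "finite_mass_currents k = {T.
     (\<forall>\<omega>\<in>test_forms k. \<forall>\<eta>\<in>test_forms k. \<forall>a c.
        T (\<lambda>x vs. a * \<omega> x vs + c * \<eta> x vs) = a * T \<omega> + c * T \<eta>) \<and>
     (\<forall>\<omega>. \<omega> \<notin> test_forms k \<longrightarrow> T \<omega> = 0) \<and>
     mass k T < \<infinity>}"

definition current_support :: "nat \<Rightarrow> 'a::euclidean_space current \<Rightarrow> 'a set" where
  "current_support k T =
     - \<Union>{U. open U \<and> (\<forall>\<omega>\<in>test_forms k. form_support \<omega> \<subseteq> U \<longrightarrow> T \<omega> = 0)}"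

text \<open>The pairing of \<open>T\<close> with a form \<open>\<eta>\<close> that is smooth only on a neighbourhood of the support
  of \<open>T\<close> and whose support meets that of \<open>T\<close> in a compact set: evaluate \<open>T\<close> on any test form
  that agrees with \<open>\<eta>\<close> near the support of \<open>T\<close>. Such a test form exists (multiply by a cutoff),
  the value does not depend on the choice, and it is \<open>T \<eta>\<close> if \<open>\<eta>\<close> is itself a test form.\<close>

definition pairing :: "nat \<Rightarrow> 'a::euclidean_space current \<Rightarrow> 'a form \<Rightarrow> real" where
  "pairing k T \<eta> = T (SOME \<eta>'. \<eta>' \<in> test_forms k \<and>
     (\<exists>U. open U \<and> current_support k T \<subseteq> U \<and> (\<forall>x\<in>U. \<eta>' x = \<eta> x)))"

definition weakstar_tendsto ::
    "nat \<Rightarrow> ('i \<Rightarrow> 'a::euclidean_space current) \<Rightarrow> 'a current \<Rightarrow> 'i filter \<Rightarrow> bool" where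
  "weakstar_tendsto k T T0 F \<longleftrightarrow> (\<forall>\<omega>\<in>test_forms k. ((\<lambda>i. T i \<omega>) \<longlongrightarrow> T0 \<omega>) F)"

section \<open>Curves of currents\<close>

text \<open>Representatives, defined at every \<open>t \<in> [0,1]\<close>, of the elements of
  \<open>L\<^sup>1([0,1]; M\<^sub>k)\<close>. Measurability is weak* measurability.\<close>

definition current_curves :: "nat \<Rightarrow> (real \<Rightarrow> 'a::euclidean_space current) set" where
  "current_curves k = {T \<in> {0..1} \<rightarrow>\<^sub>E finite_mass_currents k.
     (\<forall>\<omega>\<in>test_forms k. (\<lambda>t. T t \<omega>) \<in> borel_measurable (lebesgue_on {0..1})) \<and>
     (\<integral>\<^sup>+t. mass k (T t) \<partial>lebesgue_on {0..1}) < \<infinity>}"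

text \<open>For a curve in \<open>current_curves k\<close> the value at \<open>t = 0\<close> need not be related to the values
  at \<open>t > 0\<close>; weak* continuity is what makes \<open>T 0\<close> the datum from which \<open>T\<close> starts. In degree
  \<open>0\<close> weak* continuous solutions along a Lipschitz field are determined by their datum, so
  there nonuniqueness can hold only without this requirement.\<close>

definition weakstar_continuous :: "nat \<Rightarrow> (real \<Rightarrow> 'a::euclidean_space current) \<Rightarrow> bool" where
  "weakstar_continuous k T \<longleftrightarrow> (\<forall>t\<in>{0..1}. weakstar_tendsto k T (T t) (at t within {0..1}))"

text \<open>The weak formulation, for an autonomous field that is smooth near the supports of all
  the \<open>T t\<close>. Bochner integrability of the integrand is automatic if \<open>b\<close> is globally smooth, or
  Lipschitz.\<close>

definition weak_solution ::
    "nat \<Rightarrow> ('a::euclidean_space \<Rightarrow> 'a) \<Rightarrow> (real \<Rightarrow> 'a current) \<Rightarrow> bool" where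
  "weak_solution k b T \<longleftrightarrow>
     (\<forall>\<omega>\<in>test_forms k. \<forall>\<psi>::real \<Rightarrow> real.
        smooth_on UNIV \<psi> \<longrightarrow> closure {t. \<psi> t \<noteq> 0} \<subseteq> {0<..<1} \<longrightarrow>
        has_bochner_integral (lebesgue_on {0..1})
          (\<lambda>t. T t \<omega> * deriv \<psi> t + pairing k (T t) (lie_derivative b \<omega>) * \<psi> t) 0)"

definition consistent_family ::
    "nat \<Rightarrow> ('a::euclidean_space \<Rightarrow> 'a) \<Rightarrow> (real \<Rightarrow> 'a current) set \<Rightarrow> bool" where
  "consistent_family k b S \<longleftrightarrow>
     (\<forall>\<Omega> T. open \<Omega> \<longrightarrow> smooth_on \<Omega> b \<longrightarrow> T \<in> current_curves k \<longrightarrow>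
        (\<forall>t\<in>{0..1}. current_support k (T t) \<subseteq> \<Omega>) \<longrightarrow> weak_solution k b T \<longrightarrow> T \<in> S)"

definition stable_family :: "nat \<Rightarrow> (real \<Rightarrow> 'a::euclidean_space current) set \<Rightarrow> bool" where
  "stable_family k S \<longleftrightarrow>
     (\<forall>Tj T. (\<forall>j::nat. Tj j \<in> S) \<longrightarrow>
        (SUP j. \<integral>\<^sup>+t. mass k (Tj j t) \<partial>lebesgue_on {0..1}) < \<infinity> \<longrightarrow>
        T \<in> current_curves k \<longrightarrow>
        (\<forall>t\<in>{0..1}. weakstar_tendsto k (\<lambda>j. Tj j t) (T t) sequentially) \<longrightarrow> T \<in> S)"

definition natural_family ::
    "nat \<Rightarrow> ('a::euclidean_space \<Rightarrow> 'a) \<Rightarrow> (real \<Rightarrow> 'a current) set \<Rightarrow> bool" where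
  "natural_family k b S \<longleftrightarrow>
     S \<subseteq> current_curves k \<and> consistent_family k b S \<and> stable_family k S"

end

theory Submission
  imports Defs
begin

text \<open>
  The field is \<open>b x = (x\<^sub>2 - \<bar>x\<^sub>1\<bar>) e\<^sub>1\<close>. It is Lipschitz, but its derivative jumps across the line
  \<open>x\<^sub>1 = 0\<close>. On the side \<open>s x\<^sub>1 > 0\<close>, with \<open>s = 1\<close> or \<open>s = -1\<close>, it coincides with the linear field
  \<open>B\<^sub>s x = (x\<^sub>2 - s x\<^sub>1) e\<^sub>1\<close>, which vanishes on the ray of the points \<open>(s \<epsilon>, \<epsilon>)\<close>. A current carried by
  such a point stays there, and only its \<open>k\<close>-vector moves, under the linear flow \<open>exp (t B\<^sub>s)\<close>. Now
  \<open>e\<^sub>1\<close> is an eigenvector of \<open>B\<^sub>s\<close> for the eigenvalue \<open>- s\<close>, and \<open>- s\<close> is also the trace of \<open>B\<^sub>s\<close>. So for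
  \<open>k = 1\<close> and \<open>k = 2\<close> the current with \<open>k\<close>-vector \<open>exp (- s t) e\<^sub>1\<close>, respectively
  \<open>exp (- s t) e\<^sub>1 \<and> e\<^sub>2\<close>, at \<open>(s \<epsilon>, \<epsilon>)\<close> is a classical solution supported where \<open>b\<close> is smooth, and
  consistency puts it into every natural family. As \<open>\<epsilon>\<close> tends to \<open>0\<close> stability gives the same
  curve at the origin. The origin is reached from both sides, so the datum \<open>e\<^sub>1\<close> or \<open>e\<^sub>1 \<and> e\<^sub>2\<close> at the
  origin has a decaying and a growing solution (\<open>limit_curve_in_natural_family\<close>).

  In degree \<open>0\<close> nothing is stretched and a resting point mass is constant in time. There the weak
  formulation, tested on the open time interval, does not see the value at time \<open>0\<close>: the zero
  curve and the point mass that is present only at times \<open>t > 0\<close> have the same datum.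

  Two analytic points need care. The pairing of a current with a Lie derivative goes through an
  arbitrary test form that agrees with the Lie derivative near the support of the current. Since
  \<open>b\<close> is linear near the point, the Lie derivative along the global linear field is such a test
  form, and no cutoff is needed to produce it (\<open>lie_derivative_linear_test_form\<close>). All choices give
  the same value because a nonzero point current has its point in its support. This, like the
  distinctness of the two solutions, rests on bump functions.
\<close>

section \<open>Calculus of differentiability classes\<close>

text \<open>The class of a function on an open set depends only on its values there. On a general set
  this fails, because the derivatives are taken in the whole space.\<close>

lemma Ck_on_cong:
  assumes "open S" "\<And>x. x \<in> S \<Longrightarrow> f x = g x" "Ck_on n S f"
  shows "Ck_on n S g"
  using assms(2,3)
proof (induction n arbitrary: f g)
  case 0
  then show ?case by (simp cong: continuous_on_cong)
next
  case (Suc n)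
  have der: "(g has_derivative frechet_derivative f (at x)) (at x)" if "x \<in> S" for x
    using has_derivative_transform_within_open[OF _ \<open>open S\<close> that Suc.prems(1)] Suc.prems(2) that
    by (simp add: frechet_derivative_works)
  have "Ck_on n S (\<lambda>x. frechet_derivative g (at x) v)" for v
    by (rule Suc.IH[where f = "\<lambda>x. frechet_derivative f (at x) v"])
       (use Suc.prems(2) frechet_derivative_at[OF der] in auto)
  then show ?case using der by (auto simp: differentiable_def)
qed

text \<open>Allows any formula for the derivative in place of \<open>frechet_derivative\<close>; all closure
  properties below go through this rule.\<close>

lemma Ck_on_SucI:
  assumes "open S" "\<And>x. x \<in> S \<Longrightarrow> (f has_derivative f' x) (at x)"
    and "\<And>v. Ck_on n S (\<lambda>x. f' x v)"
  shows "Ck_on (Suc n) S f"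
proof -
  have "Ck_on n S (\<lambda>x. frechet_derivative f (at x) v)" for v
    by (rule Ck_on_cong[OF assms(1) _ assms(3)]) (rule fun_cong[OF frechet_derivative_at[OF assms(2)]])
  then show ?thesis using assms(2) by (auto simp: differentiable_def)
qed

lemma Ck_on_Suc_D: "Ck_on (Suc n) S f \<Longrightarrow> Ck_on n S f"
proof (induction n arbitrary: f)
  case 0
  then show ?case
    by (auto intro!: continuous_at_imp_continuous_on differentiable_imp_continuous_within)
next
  case (Suc n)
  from Suc.prems have "\<forall>v. Ck_on (Suc n) S (\<lambda>x. frechet_derivative f (at x) v)"
    by (subst (asm) Ck_on.simps(2)) blast
  then have "\<forall>v. Ck_on n S (\<lambda>x. frechet_derivative f (at x) v)"
    using Suc.IH by blast
  then show ?case using Suc.prems by simp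
qed

lemma Ck_on_Suc_has_derivative:
  "Ck_on (Suc n) S f \<Longrightarrow> x \<in> S \<Longrightarrow> (f has_derivative frechet_derivative f (at x)) (at x)"
  by (simp add: frechet_derivative_works)

lemma Ck_on_const: "open S \<Longrightarrow> Ck_on n S (\<lambda>x. c)"
proof (induction n arbitrary: c)
  case (Suc n)
  show ?case
    by (rule Ck_on_SucI[where f' = "\<lambda>x v. 0"])
       (rule Suc.prems has_derivative_const Suc.IH)+
qed simp

lemma Ck_on_linear:
  assumes "open S" "linear f"
  shows "Ck_on n S f"
proof (cases n)
  case 0
  then show ?thesis
    using linear_continuous_on[OF linear_conv_bounded_linear[THEN iffD1, OF assms(2)]] by simp
next
  case (Suc m)
  show ?thesis unfolding Suc
    using Ck_on_SucI[of S f "\<lambda>x. f", OF assms(1) linear_imp_has_derivative[OF assms(2)]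
        Ck_on_const[OF assms(1)]] .
qed

lemma Ck_on_add:
  assumes "open S" "Ck_on n S f" "Ck_on n S g"
  shows "Ck_on n S (\<lambda>x. f x + g x)"
  using assms(2,3)
proof (induction n arbitrary: f g)
  case 0
  then show ?case by (simp add: continuous_on_add)
next
  case (Suc n)
  have "Ck_on n S (\<lambda>x. frechet_derivative f (at x) v)" "Ck_on n S (\<lambda>x. frechet_derivative g (at x) v)" for v
    using Suc.prems by auto
  then have d: "Ck_on n S (\<lambda>x. frechet_derivative f (at x) v + frechet_derivative g (at x) v)" for v
    by (intro Suc.IH)
  show ?case
    by (rule Ck_on_SucI[OF \<open>open S\<close> has_derivative_add[OF Suc.prems[THEN Ck_on_Suc_has_derivative]] d])
qed

lemma Ck_on_mult:
  fixes f g :: "'a::euclidean_space \<Rightarrow> real"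
  assumes "open S" "Ck_on n S f" "Ck_on n S g"
  shows "Ck_on n S (\<lambda>x. f x * g x)"
  using assms(2,3)
proof (induction n arbitrary: f g)
  case 0
  then show ?case by (simp add: continuous_on_mult)
next
  case (Suc n)
  note fg = Suc.prems[THEN Ck_on_Suc_D]
  have "Ck_on n S (\<lambda>x. frechet_derivative f (at x) v)" "Ck_on n S (\<lambda>x. frechet_derivative g (at x) v)" for v
    using Suc.prems by auto
  then have d: "Ck_on n S (\<lambda>x. f x * frechet_derivative g (at x) v + frechet_derivative f (at x) v * g x)" for v
    by (intro Ck_on_add[OF \<open>open S\<close>] Suc.IH fg)
  show ?case
    by (rule Ck_on_SucI[OF \<open>open S\<close> has_derivative_mult[OF Suc.prems[THEN Ck_on_Suc_has_derivative]] d])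
qed

lemma Ck_on_sum:
  assumes "open S" "\<And>i. i \<in> I \<Longrightarrow> Ck_on n S (f i)"
  shows "Ck_on n S (\<lambda>x. \<Sum>i\<in>I. f i x)"
  using assms(2)
  by (induction I rule: infinite_finite_induct)
     (simp_all add: Ck_on_const Ck_on_add assms(1) del: Ck_on.simps)

lemma smooth_on_continuous: "smooth_on S f \<Longrightarrow> continuous_on S f"
  unfolding smooth_on_def by (metis Ck_on.simps(1))

section \<open>Bump functions\<close>

text \<open>The powers in the denominator make the family closed under differentiation up to linear
  combinations. Only \<open>m = 0\<close> enters the bump functions themselves.\<close>

definition flat :: "nat \<Rightarrow> real \<Rightarrow> real" where
  "flat m t = (if t \<le> 0 then 0 else exp (- 1 / t) / t ^ m)"

text \<open>The exponential beats every power: \<open>exp (1 / t) \<ge> (1 / (n t)) ^ n\<close> with \<open>n = m + 2\<close>. Two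
  powers of \<open>t\<close> are kept because one is spent on the difference quotient at \<open>0\<close>.\<close>

lemma flat_le_square: "\<bar>flat m t\<bar> \<le> real (m + 2) ^ (m + 2) * t\<^sup>2"
proof (cases "t \<le> 0")
  case False
  have "((1/t) / real (m+2)) ^ (m+2) \<le> (1 + (1/t) / real (m+2)) ^ (m+2)"
    using False by (intro power_mono) auto
  also have "\<dots> \<le> exp (1/t)"
    using False by (intro exp_ge_one_plus_x_over_n_power_n) (auto intro: order_trans[of _ 0])
  finally have "1 / exp (1/t) \<le> 1 / ((1/t) / real (m+2)) ^ (m+2)"
    using False by (intro divide_left_mono) auto
  also have "\<dots> = (real (m+2) * t) ^ (m+2)" using False by (simp add: field_simps)
  also have "\<dots> = real (m+2) ^ (m+2) * t\<^sup>2 * t ^ m"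
    by (simp only: power_mult_distrib power_add) (simp add: mult_ac)
  finally have "exp (- 1 / t) / t ^ m \<le> real (m+2) ^ (m+2) * t\<^sup>2"
    using False by (simp add: exp_minus field_simps)
  then show ?thesis using False by (simp add: flat_def)
qed (simp add: flat_def)

lemma flat_has_derivative:
  "(flat m has_real_derivative (- real m * flat (m+1) t + flat (m+2) t)) (at t)"
proof -
  consider "t < 0" | "t = 0" | "t > 0" by linarith
  then show ?thesis
  proof cases
    case 1
    have "((\<lambda>t. 0) has_real_derivative 0) (at t)" by simp
    then have "(flat m has_real_derivative 0) (at t)"
      by (rule has_field_derivative_transform_within_open[of _ _ _ "{..<0}"])
         (use 1 in \<open>auto simp: flat_def\<close>)
    then show ?thesis using 1 by (simp add: flat_def)
  next
    case 2
    have "((\<lambda>h. flat m h / h) \<longlongrightarrow> 0) (at 0)"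
    proof (rule Lim_null_comparison)
      show "\<forall>\<^sub>F h in at 0. norm (flat m h / h) \<le> real (m+2) ^ (m+2) * \<bar>h\<bar>"
      proof (rule always_eventually, rule allI)
        fix h :: real
        have "\<bar>flat m h\<bar> / \<bar>h\<bar> \<le> real (m+2) ^ (m+2) * h\<^sup>2 / \<bar>h\<bar>"
          by (rule divide_right_mono[OF flat_le_square]) simp
        also have "\<dots> = real (m+2) ^ (m+2) * \<bar>h\<bar>"
          by (cases "h = 0"; cases "h > 0") (simp_all add: power2_eq_square)
        finally show "norm (flat m h / h) \<le> real (m+2) ^ (m+2) * \<bar>h\<bar>" by simp
      qed
      show "((\<lambda>h. real (m+2) ^ (m+2) * \<bar>h\<bar>) \<longlongrightarrow> (0::real)) (at 0)"
        by (intro tendsto_mult_right_zero tendsto_rabs_zero tendsto_ident_at)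
    qed
    then show ?thesis using 2 by (simp add: DERIV_def flat_def)
  next
    case 3
    have "((\<lambda>t. exp (- 1 / t) / t ^ m) has_real_derivative
        (- real m * (exp (- 1 / t) / t ^ (m+1)) + exp (- 1 / t) / t ^ (m+2))) (at t)"
    proof -
      have "((\<lambda>t. exp (- 1 / t) / t ^ m) has_real_derivative
          ((exp (- 1 / t) * (1 / t\<^sup>2)) * t ^ m - exp (- 1 / t) * (real m * t ^ (m - 1))) / (t ^ m * t ^ m)) (at t)"
        using 3 by (auto intro!: derivative_eq_intros simp: power2_eq_square)
      moreover have "((e * (1 / t\<^sup>2)) * t ^ m - e * (real m * t ^ (m - 1))) / (t ^ m * t ^ m)
          = - real m * (e / t ^ (m+1)) + e / t ^ (m+2)" for e
        using 3 by (cases m) (simp_all add: field_simps power2_eq_square)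
      ultimately show ?thesis by simp
    qed
    then have "(flat m has_real_derivative
        (- real m * (exp (- 1 / t) / t ^ (m+1)) + exp (- 1 / t) / t ^ (m+2))) (at t)"
      by (rule has_field_derivative_transform_within_open[of _ _ _ "{0<..}"])
         (use 3 in \<open>auto simp: flat_def\<close>)
    then show ?thesis using 3 by (simp add: flat_def)
  qed
qed

text \<open>Differentiating \<open>q * flat m \<phi>\<close> gives products of the same kind with higher \<open>m\<close> and with a
  factor in place of \<open>q\<close> that is one order less regular. Keeping \<open>q\<close> and \<open>m\<close> general therefore
  lets the induction on the order close.\<close>

lemma Ck_on_mult_flat:
  fixes \<phi> :: "'a::euclidean_space \<Rightarrow> real"
  assumes "open S" "smooth_on S \<phi>" "Ck_on n S q"
  shows "Ck_on n S (\<lambda>x. q x * flat m (\<phi> x))"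
  using assms(3)
proof (induction n arbitrary: q m)
  case 0
  have "continuous_on UNIV (flat m)"
    by (intro continuous_at_imp_continuous_on ballI DERIV_isCont[OF flat_has_derivative])
  then have "continuous_on S (\<lambda>x. flat m (\<phi> x))"
    by (rule continuous_on_compose2[OF _ smooth_on_continuous[OF assms(2)]]) simp
  then show ?case using 0 by (simp add: continuous_on_mult)
next
  case (Suc n)
  let ?D = "\<lambda>x. frechet_derivative \<phi> (at x)" and ?Q = "\<lambda>x. frechet_derivative q (at x)"
  have \<phi>: "Ck_on (Suc n) S \<phi>" using assms(2) by (simp add: smooth_on_def del: Ck_on.simps)
  have q: "Ck_on n S q" using Suc.prems Ck_on_Suc_D by blast
  show ?case
  proof (rule Ck_on_SucI[OF assms(1)])
    fix x assume x: "x \<in> S"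
    have f: "((\<lambda>x. flat m (\<phi> x)) has_derivative
        (\<lambda>v. (- real m * flat (m+1) (\<phi> x) + flat (m+2) (\<phi> x)) * ?D x v)) (at x)"
      using has_derivative_compose[of \<phi> "?D x" x UNIV "flat m"
          "(*) (- real m * flat (m+1) (\<phi> x) + flat (m+2) (\<phi> x))",
          OF Ck_on_Suc_has_derivative[OF \<phi> x]
          flat_has_derivative[unfolded has_field_derivative_def]] .
    have eq: "q x * ((- real m * flat (m+1) (\<phi> x) + flat (m+2) (\<phi> x)) * ?D x v) + ?Q x v * flat m (\<phi> x)
      = ?Q x v * flat m (\<phi> x) + (((- real m) * (q x * ?D x v)) * flat (m+1) (\<phi> x)
           + (q x * ?D x v) * flat (m+2) (\<phi> x))" for v
      by (simp add: algebra_simps)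
    show "((\<lambda>x. q x * flat m (\<phi> x)) has_derivative
        (\<lambda>v. ?Q x v * flat m (\<phi> x) + (((- real m) * (q x * ?D x v)) * flat (m+1) (\<phi> x)
           + (q x * ?D x v) * flat (m+2) (\<phi> x)))) (at x)"
      using has_derivative_mult[of q "?Q x" x UNIV, OF Ck_on_Suc_has_derivative[OF Suc.prems x] f]
      unfolding eq .
  next
    fix v
    have "Ck_on n S (\<lambda>x. ?Q x v)" "Ck_on n S (\<lambda>x. ?D x v)" using Suc.prems \<phi> by auto
    moreover from this have "Ck_on n S (\<lambda>x. q x * ?D x v)"
      by (intro Ck_on_mult assms(1) q)
    ultimately show "Ck_on n S (\<lambda>x. ?Q x v * flat m (\<phi> x) + (((- real m) * (q x * ?D x v)) * flat (m+1) (\<phi> x)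
           + (q x * ?D x v) * flat (m+2) (\<phi> x)))"
      by (intro Ck_on_add assms(1) Suc.IH Ck_on_mult[OF assms(1) Ck_on_const[OF assms(1)]])
  qed
qed

definition bump :: "'a::euclidean_space \<Rightarrow> real \<Rightarrow> 'a \<Rightarrow> real" where
  "bump p r x = flat 0 (r\<^sup>2 - (dist x p)\<^sup>2)"

lemma smooth_on_bump: "smooth_on UNIV (bump (p::'a::euclidean_space) r)"
proof -
  have "Ck_on n UNIV (\<lambda>x. r\<^sup>2 - (dist x p)\<^sup>2)" for n
  proof (rule Ck_on_Suc_D, rule Ck_on_SucI)
    fix x
    show "((\<lambda>x. r\<^sup>2 - (dist x p)\<^sup>2) has_derivative (\<lambda>v. (-2 *\<^sub>R v) \<bullet> x + 2 * (p \<bullet> v))) (at x)"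
      unfolding dist_norm power2_norm_eq_inner
      by (auto intro!: derivative_eq_intros simp: inner_simps inner_commute)
  next
    fix v :: 'a
    have "linear (\<lambda>x. (-2 *\<^sub>R v) \<bullet> x)" by (simp add: linear_iff inner_simps)
    then show "Ck_on n UNIV (\<lambda>x. (-2 *\<^sub>R v) \<bullet> x + 2 * (p \<bullet> v))"
      by (intro Ck_on_add Ck_on_const Ck_on_linear open_UNIV)
  qed simp
  then have \<phi>: "smooth_on UNIV (\<lambda>x. r\<^sup>2 - (dist x p)\<^sup>2)" by (simp add: smooth_on_def)
  show ?thesis
    using Ck_on_mult_flat[OF open_UNIV \<phi> Ck_on_const[OF open_UNIV, of _ 1], of _ 0]
    by (simp add: smooth_on_def bump_def[abs_def])
qed

lemma bump_pos: "r > 0 \<Longrightarrow> bump p r p > 0"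
  by (simp add: bump_def flat_def)

lemma bump_zero: "r > 0 \<Longrightarrow> x \<notin> cball p r \<Longrightarrow> bump p r x = 0"
  by (auto simp: bump_def flat_def dist_commute intro!: power_mono)

section \<open>Test forms and Lie derivatives along linear fields\<close>

lemma kcovector_length: "kcovector k \<alpha> \<Longrightarrow> length vs \<noteq> k \<Longrightarrow> \<alpha> vs = 0"
  by (simp add: kcovector_def)

lemma kcovector_linear:
  "kcovector k \<alpha> \<Longrightarrow> length vs = k \<Longrightarrow> i < k \<Longrightarrow> linear (\<lambda>v. \<alpha> (vs[i := v]))"
  by (simp add: kcovector_def)

lemma kcovector_alternating:
  "kcovector k \<alpha> \<Longrightarrow> length vs = k \<Longrightarrow> i < j \<Longrightarrow> j < k \<Longrightarrow> vs ! i = vs ! j \<Longrightarrow> \<alpha> vs = 0"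
  by (simp add: kcovector_def)

lemma kcovector_lincomb:
  assumes "kcovector k \<alpha>" "kcovector k \<beta>"
  shows "kcovector k (\<lambda>vs. a * \<alpha> vs + c * \<beta> vs)"
proof -
  have "linear (\<lambda>v. a * f v + c * g v)" if "linear f" "linear g" for f g :: "'a \<Rightarrow> real"
    using that by (simp add: linear_iff algebra_simps)
  then show ?thesis using assms unfolding kcovector_def by simp
qed

text \<open>Polarization: expand the vanishing value at \<open>u + v\<close> in both slots.\<close>

lemma kcovector_swap:
  assumes \<alpha>: "kcovector k \<alpha>" and k: "length vs = k" "i < j" "j < k"
  shows "\<alpha> (vs[i := u, j := v]) + \<alpha> (vs[i := v, j := u]) = 0"
proof -
  have add_i: "\<alpha> (vs[i := x + y, j := z]) = \<alpha> (vs[i := x, j := z]) + \<alpha> (vs[i := y, j := z])" for x y z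
    using linear_add[OF kcovector_linear[OF \<alpha>, of "vs[j := z]" i]] k
    by (simp add: list_update_swap[of i j])
  have add_j: "\<alpha> (vs[i := z, j := x + y]) = \<alpha> (vs[i := z, j := x]) + \<alpha> (vs[i := z, j := y])" for x y z
    using linear_add[OF kcovector_linear[OF \<alpha>, of "vs[i := z]" j]] k by simp
  have same: "\<alpha> (vs[i := x, j := x]) = 0" for x
    by (rule kcovector_alternating[OF \<alpha>, of _ i j]) (use k in auto)
  have "\<alpha> (vs[i := u + v, j := u + v]) = 0" by (rule same)
  then show ?thesis
    using add_i[of u v "u + v"] add_j[of u u v] add_j[of v u v] same[of u] same[of v] by linarith
qed

lemma form_support_subset:
  assumes "closed K" "\<And>x vs. x \<notin> K \<Longrightarrow> \<omega> x vs = 0"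
  shows "form_support \<omega> \<subseteq> K"
  unfolding form_support_def by (rule closure_minimal) (use assms in auto)

lemma closed_form_support: "closed (form_support \<omega>)"
  by (simp add: form_support_def)

lemma zero_off_form_support: "x \<notin> form_support \<omega> \<Longrightarrow> \<omega> x vs = 0"
  using closure_subset[of "{x. \<exists>vs. \<omega> x vs \<noteq> 0}"] unfolding form_support_def by blast

lemma test_formsI:
  assumes "\<And>x. kcovector k (\<omega> x)" "\<And>n vs. Ck_on n UNIV (\<lambda>x. \<omega> x vs)"
    and "compact K" "\<And>x vs. x \<notin> K \<Longrightarrow> \<omega> x vs = 0"
  shows "\<omega> \<in> test_forms k"
proof -
  have "compact (form_support \<omega>)"
    using compact_Int_closed[OF assms(3), of "form_support \<omega>"]
      form_support_subset[OF compact_imp_closed[OF assms(3)], of \<omega>] assms(4)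
    by (simp add: form_support_def Int_absorb1)
  with assms(1,2) show ?thesis by (simp add: test_forms_def smooth_on_def del: Ck_on.simps)
qed

lemma test_forms_kcovector: "\<omega> \<in> test_forms k \<Longrightarrow> kcovector k (\<omega> x)"
  by (simp add: test_forms_def)

lemma test_forms_Ck: "\<omega> \<in> test_forms k \<Longrightarrow> Ck_on n UNIV (\<lambda>x. \<omega> x vs)"
  by (simp add: test_forms_def smooth_on_def)

lemma test_forms_compact: "\<omega> \<in> test_forms k \<Longrightarrow> compact (form_support \<omega>)"
  by (simp add: test_forms_def)

lemma test_forms_has_derivative:
  "\<omega> \<in> test_forms k \<Longrightarrow>
    ((\<lambda>y. \<omega> y vs) has_derivative frechet_derivative (\<lambda>y. \<omega> y vs) (at x)) (at x)"
  by (rule Ck_on_Suc_has_derivative[OF test_forms_Ck[of \<omega> k "Suc 0" vs] UNIV_I])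

lemma test_forms_lincomb:
  assumes "\<omega> \<in> test_forms k" "\<eta> \<in> test_forms k"
  shows "(\<lambda>x vs. a * \<omega> x vs + c * \<eta> x vs) \<in> test_forms k"
proof (rule test_formsI)
  show "kcovector k (\<lambda>vs. a * \<omega> x vs + c * \<eta> x vs)" for x
    by (rule kcovector_lincomb[OF assms[THEN test_forms_kcovector]])
  show "Ck_on n UNIV (\<lambda>x. a * \<omega> x vs + c * \<eta> x vs)" for n vs
    by (intro Ck_on_add Ck_on_mult Ck_on_const open_UNIV test_forms_Ck[OF assms(1)]
        test_forms_Ck[OF assms(2)])
  show "compact (form_support \<omega> \<union> form_support \<eta>)"
    using assms by (intro compact_Un test_forms_compact)
  fix x vs assume "x \<notin> form_support \<omega> \<union> form_support \<eta>"
  then show "a * \<omega> x vs + c * \<eta> x vs = 0"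
    using zero_off_form_support[of x \<omega> vs] zero_off_form_support[of x \<eta> vs] by simp
qed

text \<open>Test forms concentrated near a point, with a prescribed covector there up to a factor. They detect
  the support of a point current and tell different coefficients apart.\<close>

lemma bump_form:
  assumes "kcovector k \<alpha>" "r > 0"
  shows "(\<lambda>x vs. bump p r x * \<alpha> vs) \<in> test_forms k"
    and "form_support (\<lambda>x vs. bump p r x * \<alpha> vs) \<subseteq> cball p r"
proof -
  show "(\<lambda>x vs. bump p r x * \<alpha> vs) \<in> test_forms k"
  proof (rule test_formsI)
    show "kcovector k (\<lambda>vs. bump p r x * \<alpha> vs)" for x
      using kcovector_lincomb[OF assms(1,1), of "bump p r x" 0] by simp
    show "Ck_on n UNIV (\<lambda>x. bump p r x * \<alpha> vs)" for n vs
      by (rule Ck_on_mult[OF open_UNIV _ Ck_on_const[OF open_UNIV]])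
         (rule smooth_on_bump[unfolded smooth_on_def, rule_format])
    show "compact (cball p r)" by simp
  qed (use bump_zero[OF assms(2), of _ p] in simp)
  show "form_support (\<lambda>x vs. bump p r x * \<alpha> vs) \<subseteq> cball p r"
    by (rule form_support_subset) (use bump_zero[OF assms(2)] in auto)
qed

text \<open>Near a point where \<open>b\<close> is linear, the Lie derivative along \<open>b\<close> can be replaced by that
  along the global linear field.\<close>

lemma lie_derivative_cong:
  assumes "open U" "x \<in> U" "\<And>y. y \<in> U \<Longrightarrow> b y = B y" "linear B"
  shows "lie_derivative b \<omega> x = lie_derivative B \<omega> x"
proof -
  have "(B has_derivative B) (at x)" by (rule linear_imp_has_derivative[OF assms(4)])
  moreover have "(b has_derivative B) (at x)"
    using has_derivative_transform_within_open[OF calculation assms(1,2)] assms(3) by simp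
  ultimately have "frechet_derivative b (at x) = frechet_derivative B (at x)"
    using frechet_derivative_at by metis
  then show ?thesis using assms(2,3) by (simp add: lie_derivative_def)
qed

lemma lie_derivative_linear_eq:
  assumes "linear B"
  shows "lie_derivative B \<omega> x vs = frechet_derivative (\<lambda>y. \<omega> y vs) (at x) (B x) +
    (\<Sum>i<length vs. \<omega> x (vs[i := B (vs ! i)]))"
  using frechet_derivative_at[OF linear_imp_has_derivative[OF assms], of x]
  by (simp add: lie_derivative_def)

text \<open>A linear map acts on covectors as a derivation. If two arguments coincide, all but
  two summands vanish, and those two are exchanged by a swap of slots.\<close>

lemma kcovector_derivation:
  assumes \<alpha>: "kcovector k \<alpha>" and B: "linear B"
  shows "kcovector k (\<lambda>vs. \<Sum>i<length vs. \<alpha> (vs[i := B (vs ! i)]))"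
  unfolding kcovector_def
proof (intro conjI allI impI)
  fix vs :: "'a list" assume "length vs \<noteq> k"
  then show "(\<Sum>i<length vs. \<alpha> (vs[i := B (vs ! i)])) = 0"
    by (simp add: kcovector_length[OF \<alpha>])
next
  fix vs :: "'a list" and j assume k: "length vs = k" "j < k"
  have "linear (\<lambda>v. \<alpha> (vs[j := v, i := B (vs[j := v] ! i)]))" if "i < k" for i
  proof (cases "i = j")
    case True
    then show ?thesis
      using linear_compose[OF B kcovector_linear[OF \<alpha> k]] k by (simp add: o_def)
  next
    case False
    then show ?thesis
      using kcovector_linear[OF \<alpha>, of "vs[i := B (vs ! i)]" j] k
      by (simp add: list_update_swap[of i j])
  qed
  then show "linear (\<lambda>v. \<Sum>i<length (vs[j := v]). \<alpha> (vs[j := v, i := B (vs[j := v] ! i)]))"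
    using k by (simp add: linear_compose_sum)
next
  fix vs :: "'a list" and i j
  assume k: "length vs = k" "i < j" "j < k" and eq: "vs ! i = vs ! j"
  have "(\<Sum>l<length vs. \<alpha> (vs[l := B (vs ! l)])) = (\<Sum>l\<in>{i, j}. \<alpha> (vs[l := B (vs ! l)]))"
  proof (rule sum.mono_neutral_right)
    show "\<forall>l\<in>{..<length vs} - {i, j}. \<alpha> (vs[l := B (vs ! l)]) = 0"
      using k eq by (auto intro!: kcovector_alternating[OF \<alpha>, of _ i j])
  qed (use k in auto)
  also have "\<dots> = \<alpha> (vs[i := B (vs ! j)]) + \<alpha> (vs[j := B (vs ! j)])" using k eq by simp
  also have "\<dots> = \<alpha> (vs[i := B (vs ! j), j := vs ! j]) + \<alpha> (vs[i := vs ! j, j := B (vs ! j)])"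
    using list_update_id[of "vs[i := B (vs ! j)]" j] list_update_id[of vs i] k eq by simp
  also have "\<dots> = 0" by (rule kcovector_swap[OF \<alpha> k])
  finally show "(\<Sum>l<length vs. \<alpha> (vs[l := B (vs ! l)])) = 0" .
qed

lemma kcovector_directional_derivative:
  assumes \<omega>: "\<omega> \<in> test_forms k"
  shows "kcovector k (\<lambda>vs. frechet_derivative (\<lambda>y. \<omega> y vs) (at x) w)"
proof -
  note d = test_forms_has_derivative[OF \<omega>]
  have zero: "frechet_derivative (\<lambda>y. \<omega> y vs) (at x) w = 0" if "\<And>y. \<omega> y vs = 0" for vs
    using that by simp
  show ?thesis
    unfolding kcovector_def
  proof (intro conjI allI impI)
    fix vs :: "'a list" assume "length vs \<noteq> k"
    then show "frechet_derivative (\<lambda>y. \<omega> y vs) (at x) w = 0"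
      by (intro zero kcovector_length[OF test_forms_kcovector[OF \<omega>]])
  next
    fix vs :: "'a list" and i j
    assume "length vs = k" "i < j" "j < k" "vs ! i = vs ! j"
    then show "frechet_derivative (\<lambda>y. \<omega> y vs) (at x) w = 0"
      by (intro zero kcovector_alternating[OF test_forms_kcovector[OF \<omega>]])
  next
    fix vs :: "'a list" and i assume k: "length vs = k" "i < k"
    note lin = kcovector_linear[OF test_forms_kcovector[OF \<omega>] k]
    show "linear (\<lambda>v. frechet_derivative (\<lambda>y. \<omega> y (vs[i := v])) (at x) w)"
    proof (rule linearI)
      fix u v
      have "frechet_derivative (\<lambda>y. \<omega> y (vs[i := u + v])) (at x) =
          (\<lambda>w. frechet_derivative (\<lambda>y. \<omega> y (vs[i := u])) (at x) w +
               frechet_derivative (\<lambda>y. \<omega> y (vs[i := v])) (at x) w)"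
        unfolding linear_add[OF lin]
        by (rule frechet_derivative_at[OF has_derivative_add[OF d d], symmetric])
      then show "frechet_derivative (\<lambda>y. \<omega> y (vs[i := u + v])) (at x) w =
          frechet_derivative (\<lambda>y. \<omega> y (vs[i := u])) (at x) w +
          frechet_derivative (\<lambda>y. \<omega> y (vs[i := v])) (at x) w" by simp
    next
      fix c v
      have "frechet_derivative (\<lambda>y. \<omega> y (vs[i := c *\<^sub>R v])) (at x) =
          (\<lambda>w. c *\<^sub>R frechet_derivative (\<lambda>y. \<omega> y (vs[i := v])) (at x) w)"
        unfolding linear_scale[OF lin]
        by (rule frechet_derivative_at[OF has_derivative_scaleR_right[OF d], symmetric])
      then show "frechet_derivative (\<lambda>y. \<omega> y (vs[i := c *\<^sub>R v])) (at x) w =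
          c *\<^sub>R frechet_derivative (\<lambda>y. \<omega> y (vs[i := v])) (at x) w" by simp
    qed
  qed
qed

text \<open>Being a test form again, the Lie derivative along a linear field can itself serve as the
  representative in \<open>pairing\<close>. Compactness is inherited, as the Lie derivative is local.\<close>

lemma lie_derivative_linear_test_form:
  fixes B :: "'a::euclidean_space \<Rightarrow> 'a"
  assumes \<omega>: "\<omega> \<in> test_forms k" and B: "linear B"
  shows "lie_derivative B \<omega> \<in> test_forms k"
proof (rule test_formsI)
  note eq = lie_derivative_linear_eq[OF B, abs_def]
  show "kcovector k (lie_derivative B \<omega> x)" for x
    using kcovector_lincomb[OF kcovector_directional_derivative[OF \<omega>]
        kcovector_derivation[OF test_forms_kcovector[OF \<omega>] B], of 1 x "B x" 1 x]
    by (simp add: eq)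
  show "Ck_on n UNIV (\<lambda>x. lie_derivative B \<omega> x vs)" for n vs
  proof -
    have "Ck_on n UNIV (\<lambda>x. frechet_derivative (\<lambda>y. \<omega> y vs) (at x) (B x))"
    proof -
      \<comment> \<open>The direction \<open>B x\<close> moves with \<open>x\<close>; in coordinates it enters through linear factors.\<close>
      have "frechet_derivative (\<lambda>y. \<omega> y vs) (at x) (B x) =
          (\<Sum>e\<in>Basis. (B x \<bullet> e) * frechet_derivative (\<lambda>y. \<omega> y vs) (at x) e)" for x
      proof -
        have "linear (frechet_derivative (\<lambda>y. \<omega> y vs) (at x))"
          using test_forms_has_derivative[OF \<omega>] by (rule has_derivative_linear)
        then show ?thesis
          by (subst euclidean_representation[of "B x", symmetric])
             (simp add: linear_sum linear_scale)
      qed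
      moreover have "Ck_on n UNIV (\<lambda>x. \<Sum>e\<in>Basis. (B x \<bullet> e) *
          frechet_derivative (\<lambda>y. \<omega> y vs) (at x) e)"
      proof (intro Ck_on_sum Ck_on_mult open_UNIV)
        show "Ck_on n UNIV (\<lambda>x. B x \<bullet> e)" for e
          using B by (intro Ck_on_linear) (auto simp: linear_iff inner_simps)
        show "Ck_on n UNIV (\<lambda>x. frechet_derivative (\<lambda>y. \<omega> y vs) (at x) e)" for e
          using test_forms_Ck[OF \<omega>, of "Suc n" vs] by simp
      qed
      ultimately show ?thesis by simp
    qed
    then show ?thesis
      unfolding eq by (intro Ck_on_add Ck_on_sum open_UNIV test_forms_Ck[OF \<omega>])
  qed
  show "compact (form_support \<omega>)" by (rule test_forms_compact[OF \<omega>])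
  fix x vs assume x: "x \<notin> form_support \<omega>"
  have "((\<lambda>y. 0) has_derivative (\<lambda>y. 0)) (at x)" by simp
  then have "((\<lambda>y. \<omega> y vs) has_derivative (\<lambda>y. 0)) (at x)"
    by (rule has_derivative_transform_within_open[where s = "- form_support \<omega>"])
       (use x zero_off_form_support[of _ \<omega>] closed_form_support[of \<omega>] in auto)
  then have "frechet_derivative (\<lambda>y. \<omega> y vs) (at x) = (\<lambda>y. 0)"
    by (rule frechet_derivative_at[symmetric])
  then show "lie_derivative B \<omega> x vs = 0"
    using zero_off_form_support[OF x] by (simp add: eq)
qed

section \<open>Point currents\<close>

text \<open>The Dirac mass at \<open>p\<close> with the \<open>k\<close>-vector \<open>c vs\<^sub>1 \<and> \<dots> \<and> vs\<^sub>k\<close>.\<close>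

definition point_current :: "nat \<Rightarrow> 'a::euclidean_space list \<Rightarrow> 'a \<Rightarrow> real \<Rightarrow> 'a current" where
  "point_current k vs p c \<omega> = (if \<omega> \<in> test_forms k then c * \<omega> p vs else 0)"

text \<open>Comass is a supremum over orthonormal lists, one of which is \<open>vs\<close>.\<close>

lemma mass_point_current:
  fixes p :: "'a::euclidean_space"
  assumes "length vs = k" "orthonormal_list vs"
  shows "mass k (point_current k vs p c) \<le> ennreal \<bar>c\<bar>"
  unfolding mass_def
proof (rule SUP_least)
  fix \<omega> :: "'a form" assume "\<omega> \<in> {\<omega> \<in> test_forms k. \<forall>x. comass k (\<omega> x) \<le> 1}"
  then have \<omega>: "\<omega> \<in> test_forms k" and "comass k (\<omega> p) \<le> 1" by auto
  moreover have "ennreal \<bar>\<omega> p vs\<bar> \<le> comass k (\<omega> p)"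
    unfolding comass_def by (rule SUP_upper) (use assms in simp)
  ultimately have "ennreal \<bar>\<omega> p vs\<bar> \<le> 1" by (meson order_trans)
  then have "\<bar>\<omega> p vs\<bar> \<le> 1" by simp
  then have "\<bar>c * \<omega> p vs\<bar> \<le> \<bar>c\<bar>" by (simp add: abs_mult mult_left_le)
  then show "ennreal (point_current k vs p c \<omega>) \<le> ennreal \<bar>c\<bar>"
    using \<omega> by (intro ennreal_leI) (simp add: point_current_def)
qed

lemma point_current_finite_mass:
  assumes "length vs = k" "orthonormal_list vs"
  shows "point_current k vs p c \<in> finite_mass_currents k"
proof -
  have "mass k (point_current k vs p c) < \<infinity>"
    using mass_point_current[OF assms, of p c] by (simp add: order_le_less_trans)
  then show ?thesis
    by (simp add: finite_mass_currents_def point_current_def test_forms_lincomb algebra_simps)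
qed

lemma current_support_point_current: "current_support k (point_current k vs p c) \<subseteq> {p}"
proof -
  have "point_current k vs p c \<omega> = 0" if "form_support \<omega> \<subseteq> - {p}" for \<omega>
    using zero_off_form_support[of p \<omega> vs] that by (auto simp: point_current_def)
  then show ?thesis unfolding current_support_def by blast
qed

text \<open>If \<open>\<eta>\<close> is not annihilated, then neither are the forms obtained from the covector \<open>\<eta> p\<close> by
  localization near \<open>p\<close>.\<close>

lemma point_in_current_support:
  assumes \<eta>: "\<eta> \<in> test_forms k" "c * \<eta> p vs \<noteq> 0"
  shows "p \<in> current_support k (point_current k vs p c)"
proof (rule ccontr)
  assume "p \<notin> current_support k (point_current k vs p c)"
  then obtain U where U: "open U" "p \<in> U"
    and zero: "\<And>\<omega>. \<omega> \<in> test_forms k \<Longrightarrow> form_support \<omega> \<subseteq> U \<Longrightarrow> point_current k vs p c \<omega> = 0"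
    unfolding current_support_def by auto
  obtain r where r: "r > 0" "cball p r \<subseteq> U" using U open_contains_cball by blast
  let ?\<omega> = "\<lambda>x ws. bump p r x * \<eta> p ws"
  note B = bump_form[OF test_forms_kcovector[OF \<eta>(1), of p] r(1), of p]
  have "point_current k vs p c ?\<omega> = 0"
    using zero[OF B(1)] B(2) r(2) by blast
  then show False using B(1) \<eta>(2) bump_pos[OF r(1), of p] by (simp add: point_current_def)
qed

text \<open>Every representative takes the same value as \<open>\<eta>0\<close>. If \<open>p\<close> is in the support they agree at
  \<open>p\<close>; if not, the current vanishes on all test forms.\<close>

lemma pairing_point_current:
  assumes \<eta>0: "\<eta>0 \<in> test_forms k" and U: "open U" "p \<in> U" "\<And>x. x \<in> U \<Longrightarrow> \<eta> x = \<eta>0 x"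
  shows "pairing k (point_current k vs p c) \<eta> = c * \<eta>0 p vs"
proof -
  let ?T = "point_current k vs p c"
  define rep where "rep \<eta>' \<longleftrightarrow> \<eta>' \<in> test_forms k \<and>
     (\<exists>U. open U \<and> current_support k ?T \<subseteq> U \<and> (\<forall>x\<in>U. \<eta>' x = \<eta> x))" for \<eta>'
  have "rep \<eta>0"
    unfolding rep_def using \<eta>0 U current_support_point_current[of k vs p c] by (auto intro!: exI[of _ U])
  define \<eta>' where "\<eta>' = (SOME \<eta>'. rep \<eta>')"
  have rep: "rep \<eta>'" unfolding \<eta>'_def by (rule someI[of rep]) fact
  have \<eta>': "\<eta>' \<in> test_forms k" and eq: "p \<in> current_support k ?T \<Longrightarrow> \<eta>' p = \<eta>0 p"
    using rep U(2,3) unfolding rep_def by auto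
  have "c * \<eta>' p vs = c * \<eta>0 p vs"
  proof (cases "p \<in> current_support k ?T")
    case False
    then have "c * \<eta>' p vs = 0" "c * \<eta>0 p vs = 0"
      using point_in_current_support[OF \<eta>', of c p vs] point_in_current_support[OF \<eta>0, of c p vs]
      by blast+
    then show ?thesis by linarith
  qed (simp add: eq)
  then show ?thesis
    unfolding pairing_def rep_def[symmetric] \<eta>'_def[symmetric]
    using \<eta>' by (simp add: point_current_def)
qed

section \<open>Curves of point currents\<close>

text \<open>The restriction to the unit interval makes the curve extensional, as in \<open>current_curves\<close>.\<close>

definition point_curve ::
    "nat \<Rightarrow> 'a::euclidean_space list \<Rightarrow> 'a \<Rightarrow> (real \<Rightarrow> real) \<Rightarrow> real \<Rightarrow> 'a current" where
  "point_curve k vs p c = (\<lambda>t\<in>{0..1}. point_current k vs p (c t))"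

lemma point_curve_mass_integral:
  assumes vs: "length vs = k" "orthonormal_list vs"
    and M: "\<And>t. t \<in> {0..1} \<Longrightarrow> \<bar>c t\<bar> \<le> M"
  shows "(\<integral>\<^sup>+t. mass k (point_curve k vs p c t) \<partial>lebesgue_on {0..1}) \<le> ennreal M"
proof -
  have "(\<integral>\<^sup>+t. mass k (point_curve k vs p c t) \<partial>lebesgue_on {0..1})
      \<le> (\<integral>\<^sup>+t. ennreal M \<partial>lebesgue_on {0..1::real})"
  proof (rule nn_integral_mono)
    fix t :: real assume "t \<in> space (lebesgue_on {0..1})"
    then have t: "t \<in> {0..1}" by simp
    show "mass k (point_curve k vs p c t) \<le> ennreal M"
      using mass_point_current[OF vs, of p "c t"] ennreal_leI[OF M[OF t]] t
      by (auto simp: point_curve_def)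
  qed
  also have "\<dots> = ennreal M"
    by (simp add: nn_integral_const emeasure_restrict_space space_restrict_space)
  finally show ?thesis .
qed

lemma point_curve_in_current_curves:
  fixes p :: "'a::euclidean_space"
  assumes vs: "length vs = k" "orthonormal_list vs"
    and c: "c \<in> borel_measurable borel" and M: "\<And>t. t \<in> {0..1} \<Longrightarrow> \<bar>c t\<bar> \<le> M"
  shows "point_curve k vs p c \<in> current_curves k"
proof -
  have "(\<lambda>t. point_curve k vs p c t \<omega>) \<in> borel_measurable (lebesgue_on {0..1})"
    if "\<omega> \<in> test_forms k" for \<omega>
  proof -
    have "c \<in> borel_measurable (lebesgue_on {0..1})"
      using c by (intro measurable_restrict_space1 measurable_completion) simp
    then have "(\<lambda>t. c t * \<omega> p vs) \<in> borel_measurable (lebesgue_on {0..1})" by simp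
    then show ?thesis
      by (rule measurable_cong[THEN iffD1, rotated])
         (use that in \<open>simp add: point_curve_def point_current_def\<close>)
  qed
  moreover have "(\<integral>\<^sup>+t. mass k (point_curve k vs p c t) \<partial>lebesgue_on {0..1}) \<le> ennreal M"
    by (rule point_curve_mass_integral[OF vs]) (rule M)
  then have "(\<integral>\<^sup>+t. mass k (point_curve k vs p c t) \<partial>lebesgue_on {0..1}) < \<infinity>"
    by (simp add: order_le_less_trans)
  moreover have "point_curve k vs p c \<in> {0..1} \<rightarrow>\<^sub>E finite_mass_currents k"
    by (auto simp: point_curve_def intro: point_current_finite_mass[OF vs])
  ultimately show ?thesis by (simp add: current_curves_def)
qed

text \<open>Moving the point is weak* continuous because test forms are continuous. This passes
  the solutions to the line where the field is not differentiable.\<close>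

lemma point_curve_weakstar_tendsto_point:
  fixes p :: "'i \<Rightarrow> 'a::euclidean_space"
  assumes "(p \<longlongrightarrow> q) F" "t \<in> {0..1}"
  shows "weakstar_tendsto k (\<lambda>j. point_curve k vs (p j) c t) (point_curve k vs q c t) F"
  unfolding weakstar_tendsto_def
proof
  fix \<omega> :: "'a form" assume \<omega>: "\<omega> \<in> test_forms k"
  have "isCont (\<lambda>x. \<omega> x vs) q"
    using test_forms_Ck[OF \<omega>, of 0 vs] by (simp add: continuous_on_eq_continuous_at)
  then have "((\<lambda>j. c t * \<omega> (p j) vs) \<longlongrightarrow> c t * \<omega> q vs) F"
    by (intro tendsto_mult_left isCont_tendsto_compose[OF _ assms(1)])
  then show "((\<lambda>j. point_curve k vs (p j) c t \<omega>) \<longlongrightarrow> point_curve k vs q c t \<omega>) F"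
    using assms(2) \<omega> by (simp add: point_curve_def point_current_def)
qed

lemma point_curve_weakstar_continuous:
  fixes p :: "'a::euclidean_space"
  assumes "continuous_on {0..1} c"
  shows "weakstar_continuous k (point_curve k vs p c)"
  unfolding weakstar_continuous_def weakstar_tendsto_def
proof (intro ballI)
  fix t :: real and \<omega> :: "'a form" assume t: "t \<in> {0..1}" and \<omega>: "\<omega> \<in> test_forms k"
  have "((\<lambda>s. c s * \<omega> p vs) \<longlongrightarrow> c t * \<omega> p vs) (at t within {0..1})"
    using assms t by (intro tendsto_mult_right) (simp add: continuous_on_def)
  then have "((\<lambda>s. point_curve k vs p c s \<omega>) \<longlongrightarrow> c t * \<omega> p vs) (at t within {0..1})"
    by (rule Lim_transform_eventually)
       (use \<omega> in \<open>simp add: eventually_at_filter point_curve_def point_current_def\<close>)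
  then show "((\<lambda>s. point_curve k vs p c s \<omega>) \<longlongrightarrow> point_curve k vs p c t \<omega>) (at t within {0..1})"
    using \<omega> t by (simp add: point_curve_def point_current_def)
qed

lemma has_bochner_integral_deriv_unit_interval:
  fixes F f :: "real \<Rightarrow> real"
  assumes "\<And>t. (F has_real_derivative f t) (at t)" "continuous_on UNIV f"
  shows "has_bochner_integral (lebesgue_on {0..1}) f (F 1 - F 0)"
proof -
  let ?g = "\<lambda>t. indicator {0..1} t *\<^sub>R f t"
  have "has_bochner_integral lborel ?g (F 1 - F 0)"
  proof (rule has_bochner_integral_FTC_Icc)
    show "continuous_on {0..1} f" using assms(2) continuous_on_subset by blast
  qed (use assms(1) in \<open>auto simp: has_real_derivative_iff_has_vector_derivative[symmetric]
        intro: DERIV_subset\<close>)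
  then have g: "integrable lborel ?g" "integral\<^sup>L lborel ?g = F 1 - F 0"
    by (simp_all only: has_bochner_integral_iff)
  note m = borel_measurable_integrable[OF g(1)]
  have "has_bochner_integral lebesgue ?g (F 1 - F 0)"
    unfolding has_bochner_integral_iff integrable_completion[OF m] integral_completion[OF m]
    using g by blast
  then show ?thesis by (subst has_bochner_integral_restrict_space) auto
qed

text \<open>The integrand is the derivative of \<open>exp (l * t) * \<psi> t\<close>, which vanishes at both ends. This is
  the weak formulation reduced to the coefficient of a resting point current.\<close>

lemma weighted_exp_integral:
  fixes \<psi> :: "real \<Rightarrow> real"
  assumes \<psi>: "smooth_on UNIV \<psi>" "closure {t. \<psi> t \<noteq> 0} \<subseteq> {0<..<1}"
  shows "has_bochner_integral (lebesgue_on {0..1})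
    (\<lambda>t. exp (l * t) * deriv \<psi> t + l * exp (l * t) * \<psi> t) 0"
proof -
  have C1: "Ck_on (Suc 0) UNIV \<psi>" using \<psi>(1) by (simp add: smooth_on_def del: Ck_on.simps)
  have der: "(\<psi> has_real_derivative frechet_derivative \<psi> (at t) 1) (at t)" for t
  proof -
    have d: "(\<psi> has_derivative frechet_derivative \<psi> (at t)) (at t)"
      by (rule Ck_on_Suc_has_derivative[OF C1 UNIV_I])
    have "frechet_derivative \<psi> (at t) x = frechet_derivative \<psi> (at t) 1 * x" for x
      using linear_scale[OF has_derivative_linear[OF d], of x 1] by simp
    then have "frechet_derivative \<psi> (at t) = (*) (frechet_derivative \<psi> (at t) 1)" by (rule ext)
    then show ?thesis
      unfolding has_field_derivative_def by (rule has_derivative_eq_rhs[OF d])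
  qed
  then have deriv: "deriv \<psi> t = frechet_derivative \<psi> (at t) 1" for t by (rule DERIV_imp_deriv)
  have cont: "continuous_on UNIV (deriv \<psi>)" "continuous_on UNIV \<psi>"
    using C1 smooth_on_continuous[OF \<psi>(1)] by (auto simp: deriv)
  have "\<psi> 0 = 0" "\<psi> 1 = 0" using \<psi>(2) closure_subset[of "{t. \<psi> t \<noteq> 0}"] by force+
  moreover have "has_bochner_integral (lebesgue_on {0..1})
    (\<lambda>t. exp (l * t) * deriv \<psi> t + l * exp (l * t) * \<psi> t) (exp (l * 1) * \<psi> 1 - exp (l * 0) * \<psi> 0)"
  proof (rule has_bochner_integral_deriv_unit_interval[where F = "\<lambda>t. exp (l * t) * \<psi> t"])
    show "((\<lambda>t. exp (l * t) * \<psi> t) has_real_derivative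
        exp (l * t) * deriv \<psi> t + l * exp (l * t) * \<psi> t) (at t)" for t
      using der[of t, folded deriv] by (auto intro!: derivative_eq_intros)
    show "continuous_on UNIV (\<lambda>t. exp (l * t) * deriv \<psi> t + l * exp (l * t) * \<psi> t)"
      by (intro continuous_intros cont)
  qed
  ultimately show ?thesis by simp
qed

text \<open>At a zero of the field the transport term drops out of the Lie derivative, and what
  remains is the action of \<open>B\<close> on covectors. If \<open>vs\<close> spans an eigenvector of this action with
  eigenvalue \<open>l\<close>, the equation becomes \<open>c' = l c\<close>. The coefficient is prescribed only for \<open>t > 0\<close>,
  so that a jump at the initial time is allowed.\<close>

lemma point_curve_weak_solution:
  fixes B :: "'a::euclidean_space \<Rightarrow> 'a"
  assumes B: "linear B" "B p = 0" and U: "open U" "p \<in> U" "\<And>x. x \<in> U \<Longrightarrow> b x = B x"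
    and k: "length vs = k"
    and eigen: "\<And>\<alpha>. kcovector k \<alpha> \<Longrightarrow> (\<Sum>i<k. \<alpha> (vs[i := B (vs ! i)])) = l * \<alpha> vs"
    and c: "\<And>t. 0 < t \<Longrightarrow> t \<le> 1 \<Longrightarrow> c t = a * exp (l * t)"
  shows "weak_solution k b (point_curve k vs p c)"
  unfolding weak_solution_def
proof (intro ballI allI impI)
  fix \<omega> :: "'a form" and \<psi> :: "real \<Rightarrow> real"
  assume \<omega>: "\<omega> \<in> test_forms k" and \<psi>: "smooth_on UNIV \<psi>" "closure {t. \<psi> t \<noteq> 0} \<subseteq> {0<..<1}"
  let ?T = "point_curve k vs p c"
  let ?g = "\<lambda>t. (a * \<omega> p vs) * (exp (l * t) * deriv \<psi> t + l * exp (l * t) * \<psi> t)"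
  have pair: "pairing k (?T t) (lie_derivative b \<omega>) = c t * (l * \<omega> p vs)" if "t \<in> {0..1}" for t
  proof -
    have "frechet_derivative (\<lambda>y. \<omega> y vs) (at p) 0 = 0"
      by (rule linear_0[OF has_derivative_linear[OF test_forms_has_derivative[OF \<omega>]]])
    then have "lie_derivative B \<omega> p vs = l * \<omega> p vs"
      using eigen[OF test_forms_kcovector[OF \<omega>]] by (simp add: lie_derivative_linear_eq B k)
    moreover have "pairing k (point_current k vs p (c t)) (lie_derivative b \<omega>) =
        c t * lie_derivative B \<omega> p vs"
      by (rule pairing_point_current[OF lie_derivative_linear_test_form[OF \<omega> B(1)] U(1,2)])
         (rule lie_derivative_cong[OF U(1) _ U(3) B(1)])
    ultimately show ?thesis using that by (simp add: point_curve_def)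
  qed
  have "has_bochner_integral (lebesgue_on {0..1}) ?g ((a * \<omega> p vs) * 0)"
    by (rule has_bochner_integral_mult_right[OF weighted_exp_integral[OF \<psi>]])
  moreover have "has_bochner_integral (lebesgue_on {0..1}) ?g 0 \<longleftrightarrow>
    has_bochner_integral (lebesgue_on {0..1})
      (\<lambda>t. ?T t \<omega> * deriv \<psi> t + pairing k (?T t) (lie_derivative b \<omega>) * \<psi> t) 0"
  \<comment> \<open>The coefficient follows the exponential only for \<open>t > 0\<close>; the time \<open>0\<close> is a null set.\<close>
  proof (rule has_bochner_integral_discrete_difference[where X = "{0}"])
    fix t :: real assume "t \<in> space (lebesgue_on {0..1})" "t \<notin> {0}"
    then have "t \<in> {0..1}" "0 < t" "t \<le> 1" by auto
    then show "?g t = ?T t \<omega> * deriv \<psi> t + pairing k (?T t) (lie_derivative b \<omega>) * \<psi> t"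
      using pair[of t] \<omega> c[of t]
      by (simp add: point_curve_def point_current_def algebra_simps)
  qed (auto simp: emeasure_restrict_space sets_restrict_space)
  ultimately show "has_bochner_integral (lebesgue_on {0..1})
      (\<lambda>t. ?T t \<omega> * deriv \<psi> t + pairing k (?T t) (lie_derivative b \<omega>) * \<psi> t) 0" by simp
qed

section \<open>The crease field in the plane\<close>

text \<open>The basis \<open>k\<close>-vectors \<open>1\<close>, \<open>e\<^sub>1\<close>, \<open>e\<^sub>1 \<and> e\<^sub>2\<close> for \<open>k = 0, 1, 2\<close>.\<close>

definition frame :: "nat \<Rightarrow> (real^2) list" where
  "frame k = take k [axis 1 1, axis 2 1]"

text \<open>The dual covectors \<open>1\<close>, \<open>dx\<^sub>1\<close>, \<open>dx\<^sub>1 \<and> dx\<^sub>2\<close>.\<close>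

definition coframe :: "nat \<Rightarrow> (real^2) list \<Rightarrow> real" where
  "coframe k vs = (if length vs \<noteq> k then 0 else
     if k = 0 then 1 else if k = 1 then vs ! 0 $ 1
     else vs ! 0 $ 1 * vs ! 1 $ 2 - vs ! 0 $ 2 * vs ! 1 $ 1)"

definition crease_field :: "real^2 \<Rightarrow> real^2" where
  "crease_field x = axis 1 (x $ 2 - \<bar>x $ 1\<bar>)"

definition side_field :: "real \<Rightarrow> real^2 \<Rightarrow> real^2" where
  "side_field s x = axis 1 (x $ 2 - s * x $ 1)"

text \<open>The eigenvalue of \<open>side_field s\<close> acting on \<open>frame k\<close>: for \<open>k = 1\<close> the eigenvalue on \<open>e\<^sub>1\<close>, for
  \<open>k = 2\<close> the trace, for \<open>k = 0\<close> the empty sum.\<close>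

definition rate :: "real \<Rightarrow> nat \<Rightarrow> real" where
  "rate s k = (if k = 0 then 0 else - s)"

lemma length_frame: "k \<le> 2 \<Longrightarrow> length (frame k) = k"
  by (simp add: frame_def)

lemma le_2_cases: "k \<le> 2 \<Longrightarrow> k = 0 \<or> k = 1 \<or> k = (2::nat)"
  by linarith

lemma orthonormal_frame: "orthonormal_list (frame k)"
  by (auto simp: orthonormal_list_def frame_def inner_axis_axis less_Suc_eq nth_Cons')

lemma kcovector_coframe: "k \<le> 2 \<Longrightarrow> kcovector k (coframe k)"
proof -
  have "kcovector 0 (coframe 0)" "kcovector 1 (coframe 1)"
    by (auto simp: kcovector_def coframe_def linear_iff)
  moreover have "kcovector 2 (coframe 2)"
    unfolding kcovector_def
  proof (intro conjI allI impI)
    fix vs :: "(real^2) list" and i :: nat assume "length vs = 2" "i < 2"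
    moreover from this have "i = 0 \<or> i = 1" by auto
    ultimately show "linear (\<lambda>v. coframe 2 (vs[i := v]))"
      by (elim disjE) (simp_all add: coframe_def linear_iff algebra_simps)
  next
    fix vs :: "(real^2) list" and i j :: nat assume "length vs = 2" "i < j" "j < 2" "vs ! i = vs ! j"
    moreover from this have "i = 0" "j = 1" by auto
    ultimately show "coframe 2 vs = 0" by (simp add: coframe_def)
  qed (simp add: coframe_def)
  moreover assume "k \<le> 2"
  ultimately show ?thesis using le_2_cases by blast
qed

lemma coframe_frame: "k \<le> 2 \<Longrightarrow> coframe k (frame k) = 1"
  by (drule le_2_cases) (auto simp: coframe_def frame_def axis_def)

lemma linear_side_field: "linear (side_field s)"
  by (auto simp: linear_iff side_field_def axis_def vec_eq_iff algebra_simps)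

lemma side_field_frame:
  "side_field s (axis 1 1) = - s *\<^sub>R axis 1 1" "side_field s (axis 2 1) = axis 1 1"
  by (auto simp: side_field_def axis_def vec_eq_iff)

text \<open>The matrix of \<open>side_field s\<close> is upper triangular with diagonal \<open>- s, 0\<close>. For \<open>k = 2\<close> the summand
  of the second slot vanishes because \<open>e\<^sub>2\<close> is mapped to \<open>e\<^sub>1\<close>, which already occupies the first.\<close>

lemma frame_eigen:
  assumes "k \<le> 2" and \<alpha>: "kcovector k \<alpha>"
  shows "(\<Sum>i<k. \<alpha> ((frame k)[i := side_field s (frame k ! i)])) = rate s k * \<alpha> (frame k)"
proof -
  have first: "\<alpha> ((frame k)[0 := - s *\<^sub>R axis 1 1]) = - s * \<alpha> (frame k)" if "0 < k"
  proof -
    have "(frame k)[0 := axis 1 1] = frame k" using that by (cases k) (auto simp: frame_def)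
    then show ?thesis
      using linear_scale[OF kcovector_linear[OF \<alpha> length_frame[OF assms(1)] that], of "- s" "axis 1 1"]
      by simp
  qed
  have second: "\<alpha> [axis 1 1, axis 1 1] = 0" if "k = 2"
    by (rule kcovector_alternating[OF \<alpha>, of _ 0 1]) (use that in auto)
  from le_2_cases[OF assms(1)] show ?thesis
    using first second
    by (auto simp: rate_def frame_def side_field_frame numeral_2_eq_2)
qed

lemma crease_field_eq_side_field:
  "s \<in> {-1, 1} \<Longrightarrow> s * x $ 1 > 0 \<Longrightarrow> crease_field x = side_field s x"
  by (auto simp: crease_field_def side_field_def)

lemma crease_field_lipschitz: "2-lipschitz_on UNIV crease_field"
proof (rule lipschitz_onI)
  fix x y :: "real^2"
  have "dist (crease_field x) (crease_field y) = \<bar>(x $ 2 - \<bar>x $ 1\<bar>) - (y $ 2 - \<bar>y $ 1\<bar>)\<bar>"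
    unfolding dist_norm crease_field_def
    by (simp add: norm_vec_def L2_set_def axis_def UNIV_2)
  also have "\<dots> \<le> \<bar>(x - y) $ 2\<bar> + \<bar>(x - y) $ 1\<bar>" by simp
  also have "\<dots> \<le> norm (x - y) + norm (x - y)" by (intro add_mono component_le_norm_cart)
  finally show "dist (crease_field x) (crease_field y) \<le> 2 * dist x y" by (simp add: dist_norm)
qed simp

lemma open_side: "open {x :: real^2. s * x $ 1 > 0}"
  by (intro open_Collect_less continuous_intros)

lemma crease_field_smooth_on_side:
  assumes "s \<in> {-1, 1}"
  shows "smooth_on {x. s * x $ 1 > 0} crease_field"
  unfolding smooth_on_def
proof
  fix n
  show "Ck_on n {x. s * x $ 1 > 0} crease_field"
    by (rule Ck_on_cong[OF open_side _ Ck_on_linear[OF open_side linear_side_field]])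
       (use crease_field_eq_side_field[OF assms] in simp)
qed

text \<open>A zero of \<open>side_field s\<close> which, for \<open>e > 0\<close> and \<open>s = 1\<close> or \<open>s = -1\<close>, lies on the side
  where this linear field equals the crease field.\<close>

definition side_point :: "real \<Rightarrow> real \<Rightarrow> real^2" where
  "side_point s e = vector [s * e, e]"

text \<open>The curve at the origin inherits the growth rate of whichever side it is approached
  from. This is the source of nonuniqueness: the sign \<open>s\<close> is free.\<close>

lemma limit_curve_in_natural_family:
  assumes k: "k \<le> 2" and S: "natural_family k crease_field S" and s: "s \<in> {-1, 1}"
    and c: "\<And>t. 0 < t \<Longrightarrow> t \<le> 1 \<Longrightarrow> c t = a * exp (rate s k * t)"
    and meas: "c \<in> borel_measurable borel" and M: "\<And>t. t \<in> {0..1} \<Longrightarrow> \<bar>c t\<bar> \<le> M"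
  shows "point_curve k (frame k) 0 c \<in> S"
proof -
  note frame = length_frame[OF k] orthonormal_frame[of k]
  define p where "p j = side_point s (1 / real (Suc j))" for j
  have p: "s * p j $ 1 > 0" and stationary: "side_field s (p j) = 0" for j
    using s by (auto simp: p_def side_point_def vector_2 side_field_def axis_def vec_eq_iff)
  have curve: "point_curve k (frame k) q c \<in> current_curves k" for q
    by (rule point_curve_in_current_curves[OF frame meas]) (rule M)
  have "point_curve k (frame k) (p j) c \<in> S" for j
  proof -
    have "weak_solution k crease_field (point_curve k (frame k) (p j) c)"
      by (rule point_curve_weak_solution[OF linear_side_field stationary open_side _ _
            frame(1) frame_eigen[OF k] c])
         (use p[of j] crease_field_eq_side_field[OF s] in simp_all)
    moreover have "\<forall>t\<in>{0..1}. current_support k (point_curve k (frame k) (p j) c t)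
        \<subseteq> {x. s * x $ 1 > 0}"
      using current_support_point_current[of k "frame k" "p j"] p[of j]
      by (auto simp: point_curve_def)
    moreover have "consistent_family k crease_field S" using S by (simp add: natural_family_def)
    ultimately show ?thesis
      using curve[of "p j"] open_side[of s] crease_field_smooth_on_side[OF s]
      unfolding consistent_family_def by simp
  qed
  moreover have "(SUP j. \<integral>\<^sup>+t. mass k (point_curve k (frame k) (p j) c t) \<partial>lebesgue_on {0..1}) < \<infinity>"
  proof -
    have "(SUP j. \<integral>\<^sup>+t. mass k (point_curve k (frame k) (p j) c t) \<partial>lebesgue_on {0..1}) \<le> ennreal M"
      by (rule SUP_least) (rule point_curve_mass_integral[OF frame M])
    then show ?thesis by (simp add: order_le_less_trans)
  qed
  moreover have "weakstar_tendsto k (\<lambda>j. point_curve k (frame k) (p j) c t)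
      (point_curve k (frame k) 0 c t) sequentially" if "t \<in> {0..1}" for t
  proof (rule point_curve_weakstar_tendsto_point[OF _ that])
    have e: "(\<lambda>j. 1 / real (Suc j)) \<longlonglongrightarrow> 0" by (rule LIMSEQ_Suc[OF lim_1_over_n])
    have "(\<lambda>j. p j $ i) \<longlonglongrightarrow> 0 $ i" for i
      using e tendsto_mult_right_zero[OF e, of s] exhaust_2[of i]
      by (auto simp: p_def side_point_def vector_2)
    then show "p \<longlonglongrightarrow> 0" by (rule vec_tendstoI)
  qed
  moreover have "stable_family k S" using S by (simp add: natural_family_def)
  ultimately show ?thesis
    using curve[of 0] unfolding stable_family_def
    by (elim allE[of _ "\<lambda>j. point_curve k (frame k) (p j) c"]
        allE[of _ "point_curve k (frame k) 0 c"]) simp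
qed

lemma point_curves_differ:
  assumes k: "k \<le> 2" and differ: "\<And>t. 0 < t \<Longrightarrow> t \<le> 1 \<Longrightarrow> c t \<noteq> d t"
  shows "\<not> (AE t in lebesgue_on {0..1}. point_curve k (frame k) p c t = point_curve k (frame k) p d t)"
proof
  let ?\<omega> = "\<lambda>x vs. bump p 1 x * coframe k vs"
  have \<omega>: "?\<omega> \<in> test_forms k" "?\<omega> p (frame k) \<noteq> 0"
    using bump_form(1)[OF kcovector_coframe[OF k] zero_less_one, of p] bump_pos[of 1 p]
    by (simp_all add: coframe_frame[OF k])
  have "t \<in> {0}" if "t \<in> {0..1}"
    "point_curve k (frame k) p c t = point_curve k (frame k) p d t" for t
  proof (rule ccontr)
    assume "t \<notin> {0}"
    have "c t * ?\<omega> p (frame k) = d t * ?\<omega> p (frame k)"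
      using fun_cong[OF that(2), of ?\<omega>] that(1) \<omega>(1) by (simp add: point_curve_def point_current_def)
    then show False using differ[of t] that(1) \<open>t \<notin> {0}\<close> \<omega>(2) by auto
  qed
  note eq_imp = this
  assume ae: "AE t in lebesgue_on {0..1}.
    point_curve k (frame k) p c t = point_curve k (frame k) p d t"
  have "AE t in lebesgue_on {0..1::real}. t \<in> {0}"
    by (rule AE_mp[OF ae AE_I2]) (use eq_imp in simp)
  then have "AE t in lebesgue. t \<in> {0..1::real} \<longrightarrow> t \<in> {0}"
    by (subst (asm) AE_restrict_space_iff) auto
  then have "AE t in lebesgue. \<not> (0 < t \<and> t \<le> (1::real))" by (rule eventually_mono) auto
  then have "emeasure lebesgue {0<..1::real} = 0"
    using emeasure_eq_0_AE[of "\<lambda>t. 0 < t \<and> t \<le> (1::real)" lebesgue]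
    by (simp add: greaterThanAtMost_def greaterThan_def atMost_def Collect_conj_eq)
  then show False by simp
qed

theorem proposition6p3:
  shows "\<exists>b :: real^2 \<Rightarrow> real^2. (\<exists>L. L-lipschitz_on UNIV b) \<and>
    (\<forall>k\<le>2. \<forall>S. natural_family k b S \<longrightarrow>
      (\<exists>T1\<in>S. \<exists>T2\<in>S. T1 0 = T2 0 \<and> \<not> (AE t in lebesgue_on {0..1}. T1 t = T2 t) \<and>
         (1 \<le> k \<longrightarrow> weakstar_continuous k T1 \<and> weakstar_continuous k T2)))"
proof (intro exI[of _ crease_field] conjI allI impI exI[of _ 2] crease_field_lipschitz)
  fix k :: nat and S assume k: "k \<le> 2" and S: "natural_family k crease_field S"
  let ?T = "point_curve k (frame k) 0"
  note in_S = limit_curve_in_natural_family[OF k S]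
  show "\<exists>T1\<in>S. \<exists>T2\<in>S. T1 0 = T2 0 \<and> \<not> (AE t in lebesgue_on {0..1}. T1 t = T2 t) \<and>
      (1 \<le> k \<longrightarrow> weakstar_continuous k T1 \<and> weakstar_continuous k T2)"
  proof (cases "k = 0")
    case True
    \<comment> \<open>The rate is \<open>0\<close>: nothing at all against a point mass that appears right after time \<open>0\<close>.\<close>
    let ?d = "\<lambda>t::real. if t = 0 then 0 else (1::real)"
    have "?T (\<lambda>t. 0) \<in> S" by (rule in_S[of 1 _ 0 0]) auto
    moreover have "?T ?d \<in> S" by (rule in_S[of 1 _ 1 1]) (auto simp: rate_def True)
    moreover have "?T (\<lambda>t. 0) 0 = ?T ?d 0" by (simp add: point_curve_def)
    moreover have "\<not> (AE t in lebesgue_on {0..1}. ?T (\<lambda>t. 0) t = ?T ?d t)"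
      by (rule point_curves_differ[OF k]) auto
    moreover have "\<not> 1 \<le> k" using True by simp
    ultimately show ?thesis by blast
  next
    case False
    \<comment> \<open>Approach from the right gives decay, approach from the left gives growth.\<close>
    let ?c = "\<lambda>t::real. exp (- t)"
    have "?T ?c \<in> S"
      by (rule in_S[of 1 _ 1 1]) (auto simp: rate_def False)
    moreover have "?T exp \<in> S"
      by (rule in_S[of "-1" _ 1 "exp 1"]) (auto simp: rate_def False)
    moreover have "?T ?c 0 = ?T exp 0" by (simp add: point_curve_def)
    moreover have "\<not> (AE t in lebesgue_on {0..1}. ?T ?c t = ?T exp t)"
      by (rule point_curves_differ[OF k]) auto
    moreover have "weakstar_continuous k (?T ?c)" "weakstar_continuous k (?T exp)"
      by (intro point_curve_weakstar_continuous continuous_intros)+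
    ultimately show ?thesis by blast
  qed
qed

end
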